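(* Let $p(x,y)\in\mathbb R[x_1,\dots,x_m,y_1]$, $S=[-1,1]=\{y_1\in\mathbb R\mid g_1(y_1):=1-y_1^2\ge0\}$, $G=\{g_1\}$, $\mathbf K=\{x\in\mathbb R^m\mid p(x,y)\ge0\ \forall y\in S\}$. Suppose that $\mathbf K$ is compact with $\|x\|_2\le\tau_{\mathbf K}$ for all $x\in\mathbf K$ (where $\tau_{\mathbf K}>0$), that the Slater condition holds for $\mathbf K$, and that $-p(x,y)$ is s.o.s-convex in $x$ for every $y\in S$. Then $\mathbf K=\Lambda_{r,t}$ for all integers $r\ge\lceil d_x/2\rceil$ and $t\ge d_{\mathbf K}$.
   Context: $\mathbb R[x]_k$ denotes polynomials in $x=(x_1,\dots,x_m)$ of total degree at most $k$; $(\cdot)^*$ denotes the dual space of linear functionals. A polynomial is s.o.s if it is a finite sum of squares of polynomials. A polynomial $h\in\mathbb R[x]$ is s.o.s-convex if there are an integer $k$ and a matrix polynomial $H\in\mathbb R[x]^{k\times m}$ with $\nabla^2h(x)=H(x)^TH(x)$. Slater condition for $\mathbf K$: there is $u\in\mathbf K$ with $p(u,y)>0$ for all $y\in S$. $d_x=\deg_x p$, $d_y=\deg_y p$, $d_{\mathbf K}:=\max\{\lceil d_y/2\rceil,1\}$. With $g_0:=1$, $\mathbf{qmodule}_t(G):=\{\sigma_0+g_1\sigma_1\mid\sigma_0,\sigma_1\in\mathbb R[y_1]\text{ s.o.s},\ \deg\sigma_0\le2t,\ \deg(g_1\sigma_1)\le2t\}$. $\Theta_k(x):=\sum_{i=1}^m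 (x_i/\tau_{\mathbf K})^{2k}$. For $\mathscr L\in(\mathbb R[x]_{2r})^*$ with $2r\ge d_x$, $\mathscr L(p(x,y))\in\mathbb R[y_1]$ denotes the result of applying $\mathscr L$ to $p$ viewed as a polynomial in $x$ with coefficients in $\mathbb R[y_1]$. $\Lambda_{r,t}\subseteq\mathbb R^m$ is the set of all points $(\mathscr L(x_1),\dots,\mathscr L(x_m))$ where $\mathscr L\in(\mathbb R[x]_{2r})^*$ satisfies: $\mathscr L(1)=1$; $\mathscr L(q^2)\ge0$ for all $q\in\mathbb R[x]_r$; $\mathscr L(\Theta_k)\le1$ for $k=\lceil d_x/2\rceil,\dots,r$; and $\mathscr L(p(x,y))\in\mathbf{qmodule}_t(G)$. *)

theory Defs
  imports "HOL-Analysis.Analysis" "HOL-Library.Poly_Mapping"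
    "HOL-Computational_Algebra.Polynomial"
begin

text \<open>
  Exponent vectors are finitely supported maps from the variable index type, so
  \<open>('i, 'a) mpoly\<close> is the polynomial ring in the variables \<open>x\<^sub>i\<close> with coefficients
  in \<open>'a\<close>; its ring operations are the convolution ones of the library.
  \<open>\<real>[x]\<close> is \<open>('m, real) mpoly\<close>, and \<open>\<real>[x, y\<^sub>1]\<close> is \<open>('m, real poly) mpoly\<close>, i.e.
  polynomials in \<open>x\<close> with coefficients in \<open>\<real>[y\<^sub>1]\<close>.
\<close>

type_synonym ('i, 'a) mpoly = "('i \<Rightarrow>\<^sub>0 nat) \<Rightarrow>\<^sub>0 'a"

definition Const :: "real \<Rightarrow> ('m, real) mpoly" where
  "Const c = Poly_Mapping.single 0 c"

definition mono_of :: "('m \<Rightarrow>\<^sub>0 nat) \<Rightarrow> ('m, real) mpoly" where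
  "mono_of a = Poly_Mapping.single a 1"

definition Var :: "'m \<Rightarrow> ('m, real) mpoly" where
  "Var i = mono_of (Poly_Mapping.single i 1)"

definition mdeg :: "('m::finite \<Rightarrow>\<^sub>0 nat) \<Rightarrow> nat" where
  "mdeg a = (\<Sum>i\<in>UNIV. Poly_Mapping.lookup a i)"

definition insertion :: "('m::finite, real) mpoly \<Rightarrow> real ^ 'm \<Rightarrow> real" where
  "insertion f x = (\<Sum>a\<in>Poly_Mapping.keys f.
     Poly_Mapping.lookup f a * (\<Prod>i\<in>UNIV. (x $ i) ^ Poly_Mapping.lookup a i))"

definition at_y :: "('m, real poly) mpoly \<Rightarrow> real \<Rightarrow> ('m, real) mpoly" where
  "at_y p y = Poly_Mapping.map (\<lambda>c. poly c y) p"

definition deg_x :: "('m::finite, real poly) mpoly \<Rightarrow> nat" where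
  "deg_x p = Max (insert 0 (mdeg ` Poly_Mapping.keys p))"

definition deg_y :: "('m, real poly) mpoly \<Rightarrow> nat" where
  "deg_y p = Max (insert 0 ((\<lambda>a. degree (Poly_Mapping.lookup p a)) ` Poly_Mapping.keys p))"

definition polys_le :: "nat \<Rightarrow> ('m::finite, real) mpoly set" where
  "polys_le k = {f. \<forall>a\<in>Poly_Mapping.keys f. mdeg a \<le> k}"

text \<open>
  The truncated subtraction \<open>a - single i 1\<close> is harmless: where the exponent of
  \<open>x\<^sub>i\<close> is \<open>0\<close>, the coefficient vanishes.
\<close>

definition pdiff :: "'m \<Rightarrow> ('m, real) mpoly \<Rightarrow> ('m, real) mpoly" where
  "pdiff i f = (\<Sum>a\<in>Poly_Mapping.keys f.
     Poly_Mapping.single (a - Poly_Mapping.single i 1)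
       (real (Poly_Mapping.lookup a i) * Poly_Mapping.lookup f a))"

definition sos :: "'a::comm_semiring_1 \<Rightarrow> bool" where
  "sos f \<longleftrightarrow> (\<exists>(n::nat) q. f = (\<Sum>l<n. (q l)\<^sup>2))"

text \<open>
  The \<open>(i, j)\<close> entry of the identity \<open>\<nabla>\<^sup>2h = H\<^sup>TH\<close> with
  \<open>H \<in> \<real>[x]\<close> of format \<open>k \<times> m\<close>, rows indexed by \<open>l < k\<close>.
\<close>

definition sos_convex :: "('m::finite, real) mpoly \<Rightarrow> bool" where
  "sos_convex h \<longleftrightarrow> (\<exists>(k::nat) (H :: nat \<Rightarrow> 'm \<Rightarrow> ('m, real) mpoly).
     \<forall>i j. pdiff i (pdiff j h) = (\<Sum>l<k. H l i * H l j))"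

definition g1 :: "real poly" where
  "g1 = [:1, 0, -1:]"

definition S :: "real set" where
  "S = {y. poly g1 y \<ge> 0}"

lemma S_eq: "S = {-1..1}"
proof -
  have "poly g1 y \<ge> 0 \<longleftrightarrow> y \<in> {-1..1}" for y
  proof -
    have "poly g1 y = 1 - y\<^sup>2"
      by (simp add: g1_def power2_eq_square)
    moreover have "y\<^sup>2 \<le> 1 \<longleftrightarrow> \<bar>y\<bar> \<le> 1"
      by (rule abs_square_le_1)
    moreover have "\<bar>y\<bar> \<le> 1 \<longleftrightarrow> y \<in> {-1..1}"
      unfolding atLeastAtMost_iff by linarith
    ultimately show ?thesis
      by linarith
  qed
  then show ?thesis
    unfolding S_def by blast
qed

definition K :: "('m::finite, real poly) mpoly \<Rightarrow> (real ^ 'm) set" where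
  "K p = {x. \<forall>y\<in>S. insertion (at_y p y) x \<ge> 0}"

definition slater :: "('m::finite, real poly) mpoly \<Rightarrow> bool" where
  "slater p \<longleftrightarrow> (\<exists>u\<in>K p. \<forall>y\<in>S. insertion (at_y p y) u > 0)"

definition d_K :: "('m, real poly) mpoly \<Rightarrow> nat" where
  "d_K p = max (nat \<lceil>real (deg_y p) / 2\<rceil>) 1"

text \<open>The truncated quadratic module of \<open>G = {g}\<close>.\<close>

definition qmodule :: "nat \<Rightarrow> real poly \<Rightarrow> real poly set" where
  "qmodule t g = {\<sigma>0 + g * \<sigma>1 | \<sigma>0 \<sigma>1.
     sos \<sigma>0 \<and> sos \<sigma>1 \<and> degree \<sigma>0 \<le> 2 * t \<and> degree (g * \<sigma>1) \<le> 2 * t}"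

definition Theta :: "real \<Rightarrow> nat \<Rightarrow> ('m::finite, real) mpoly" where
  "Theta \<tau> k = (\<Sum>i\<in>UNIV. (Const (1 / \<tau>) * Var i) ^ (2 * k))"

text \<open>
  The dual space of \<open>\<real>[x]\<^sub>k\<close>; functionals are total functions in HOL, made unique by
  extensionality off \<open>\<real>[x]\<^sub>k\<close>.
\<close>

definition dual :: "nat \<Rightarrow> (('m::finite, real) mpoly \<Rightarrow> real) set" where
  "dual k = {L \<in> extensional (polys_le k).
     (\<forall>f\<in>polys_le k. \<forall>g\<in>polys_le k. L (f + g) = L f + L g) \<and>
     (\<forall>c. \<forall>f\<in>polys_le k. L (Const c * f) = c * L f)}"

definition apply_x ::
  "(('m, real) mpoly \<Rightarrow> real) \<Rightarrow> ('m, real poly) mpoly \<Rightarrow> real poly" where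
  "apply_x L p =
     (\<Sum>a\<in>Poly_Mapping.keys p. smult (L (mono_of a)) (Poly_Mapping.lookup p a))"

definition Lambda ::
  "('m::finite, real poly) mpoly \<Rightarrow> real \<Rightarrow> nat \<Rightarrow> nat \<Rightarrow> (real ^ 'm) set" where
  "Lambda p \<tau> r t = {(\<chi> i. L (Var i)) | L.
     L \<in> dual (2 * r) \<and>
     L 1 = 1 \<and>
     (\<forall>q\<in>polys_le r. L (q\<^sup>2) \<ge> 0) \<and>
     (\<forall>k\<in>{nat \<lceil>real (deg_x p) / 2\<rceil>..r}. L (Theta \<tau> k) \<le> 1) \<and>
     apply_x L p \<in> qmodule t g1}"

end

theory Submission imports Defs begin

text \<open>
  A point \<open>x\<close> of \<open>K\<close> is represented by evaluation at \<open>x\<close>: the polynomial \<open>p(x, y)\<close> is nonnegative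
  on \<open>[-1, 1]\<close>, hence lies in the truncated quadratic module by the theorem of Markov and Lukacs.
  Conversely, a functional \<open>L\<close> that is nonnegative on squares satisfies Jensen's inequality for
  s.o.s-convex polynomials, so that \<open>p(L(x), y) \<ge> L(p(x, y)) \<ge> 0\<close> on \<open>[-1, 1]\<close>.
  Compactness and the Slater condition only serve to exclude \<open>deg\<^sub>x p = 0\<close>, where
  \<open>\<Theta>\<^sub>0 = m\<close> would violate the bound.
\<close>

section \<open>Nonnegative polynomials on an interval\<close>

text \<open>Truncation shapes the proof. \<open>L\<close> is defined only up to degree
  \<open>2 * r\<close>, its positivity is known only for squares of polynomials of degree at most
  \<open>r\<close>, and the module in \<open>y\<close> stops at degree \<open>2 * t\<close>. So on
  the interval a certificate of some degree does not suffice: sharp bounds have to travel through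
  the induction. For Jensen's inequality, \<open>L\<close> need not come from a measure, so the
  classical version does not apply; the argument differentiates along a segment instead. There the
  factor \<open>H\<close> of the Hessian comes without any degree bound. One is recovered from the
  diagonal of the Hessian: top-degree squares cannot cancel over the reals, so the entries of
  \<open>H\<close> have degree at most \<open>r - 1\<close>, and multiplying them by the affine
  polynomials \<open>X - x\<close> stays within degree \<open>r\<close>, exactly where positivity is
  available.\<close>

lemma sos_zero: "sos 0"
  unfolding sos_def by (rule exI[of _ 0]) simp

lemma sos_add:
  assumes "sos f" "sos g"
  shows "sos (f + g)"
proof -
  obtain n m :: nat and q u where f: "f = (\<Sum>l<n. (q l)\<^sup>2)" and g: "g = (\<Sum>l<m. (u l)\<^sup>2)"
    using assms unfolding sos_def by blast
  define w where "w l = (if l < n then q l else u (l - n))" for l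
  have "(\<Sum>l<n + m. (w l)\<^sup>2) = f + g"
    unfolding f g by (induction m) (simp_all add: w_def add.assoc)
  then show ?thesis
    unfolding sos_def by metis
qed

lemma sos_mult_square:
  assumes "sos f"
  shows "sos (a\<^sup>2 * f)"
proof -
  obtain n :: nat and q where f: "f = (\<Sum>l<n. (q l)\<^sup>2)"
    using assms unfolding sos_def by blast
  have "a\<^sup>2 * f = (\<Sum>l<n. (a * q l)\<^sup>2)"
    unfolding f by (simp add: sum_distrib_left power_mult_distrib)
  then show ?thesis
    unfolding sos_def by metis
qed

lemma sos_const_poly:
  assumes "c \<ge> 0"
  shows "sos [:c::real:]"
  unfolding sos_def
  by (rule exI[of _ 1], rule exI[of _ "\<lambda>_. [:sqrt c:]"])
    (use assms in \<open>simp add: power2_eq_square\<close>)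

lemma poly_sos_nonneg: "sos f \<Longrightarrow> poly f (y::real) \<ge> 0"
  unfolding sos_def by (auto simp: poly_sum intro!: sum_nonneg)

text \<open>
  The odd case, with certificates \<open>(1 - y) \<sigma>\<^sub>0 + (1 + y) \<sigma>\<^sub>1\<close>, is what makes the induction on
  the degree close up: dividing by one linear factor changes the parity.
\<close>

definition interval_cert :: "nat \<Rightarrow> real poly \<Rightarrow> bool" where
  "interval_cert d f \<longleftrightarrow>
    (if even d
     then \<exists>s0 s1. sos s0 \<and> sos s1 \<and> degree s0 \<le> d \<and> degree (g1 * s1) \<le> d \<and> f = s0 + g1 * s1
     else \<exists>s0 s1. sos s0 \<and> sos s1 \<and> degree s0 < d \<and> degree s1 < d \<and>
       f = [:1, -1:] * s0 + [:1, 1:] * s1)"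

lemma g1_factor: "g1 = [:1, -1:] * [:1, 1:]"
  by (simp add: g1_def)

lemma degree_g1_mult: "s \<noteq> 0 \<Longrightarrow> degree (g1 * s) = degree s + 2"
proof -
  assume "s \<noteq> 0"
  moreover have "degree g1 = 2" "g1 \<noteq> 0"
    by (simp_all add: g1_def)
  ultimately show ?thesis
    by (simp add: degree_mult_eq)
qed

lemma degree_linear_square: "c \<noteq> 0 \<Longrightarrow> degree ([:a, c :: real:]\<^sup>2) = 2"
  by (simp add: degree_power_eq)

lemma interval_cert_add:
  assumes "interval_cert d f" "interval_cert d h"
  shows "interval_cert d (f + h)"
proof (cases "even d")
  case True
  then obtain s0 s1 u0 u1 where *: "sos s0" "sos s1" "degree s0 \<le> d" "degree (g1 * s1) \<le> d"
      "f = s0 + g1 * s1" "sos u0" "sos u1" "degree u0 \<le> d" "degree (g1 * u1) \<le> d"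
      "h = u0 + g1 * u1"
    using assms unfolding interval_cert_def by auto
  have "f + h = (s0 + u0) + g1 * (s1 + u1)" "degree (s0 + u0) \<le> d" "degree (g1 * (s1 + u1)) \<le> d"
    using * by (simp_all add: algebra_simps degree_add_le)
  then show ?thesis
    unfolding interval_cert_def using True * sos_add by metis
next
  case False
  then obtain s0 s1 u0 u1 where *: "sos s0" "sos s1" "degree s0 < d" "degree s1 < d"
      "f = [:1, -1:] * s0 + [:1, 1:] * s1" "sos u0" "sos u1" "degree u0 < d" "degree u1 < d"
      "h = [:1, -1:] * u0 + [:1, 1:] * u1"
    using assms unfolding interval_cert_def by auto
  have "f + h = [:1, -1:] * (s0 + u0) + [:1, 1:] * (s1 + u1)"
    using * by (simp only: algebra_simps)
  moreover have "degree (s0 + u0) < d" "degree (s1 + u1) < d"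
    using * by (simp_all add: degree_add_less)
  ultimately show ?thesis
    unfolding interval_cert_def using False * sos_add by metis
qed

lemma interval_cert_const:
  assumes "c \<ge> 0"
  shows "interval_cert d [:c:]"
proof (cases "even d")
  case True
  then show ?thesis
    unfolding interval_cert_def
    unfolding if_P[OF True] by (intro exI[of _ "[:c:]"] exI[of _ 0]) (simp add: sos_zero sos_const_poly assms)
next
  case False
  then show ?thesis
    unfolding interval_cert_def
    \<comment> \<open>The weights \<open>1 - y\<close> and \<open>1 + y\<close> add up to 2, so each
      carries half of the constant.\<close>
    by (auto intro!: exI[of _ "[:c/2:]"] simp: sos_const_poly assms odd_pos)
qed

lemma interval_cert_mult_square:
  assumes "interval_cert d h"
  shows "interval_cert (d + 2) ([:a, 1:]\<^sup>2 * h)"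
proof (cases "even d")
  case True
  let ?q = "[:a, 1::real:]\<^sup>2"
  obtain s0 s1 where *: "sos s0" "sos s1" "degree s0 \<le> d" "degree (g1 * s1) \<le> d"
      "h = s0 + g1 * s1"
    using assms True unfolding interval_cert_def by auto
  have "?q * h = ?q * s0 + g1 * (?q * s1)"
    using * by (simp only: algebra_simps)
  moreover have "degree (?q * s0) \<le> d + 2"
    using degree_mult_le[of ?q s0] * by (simp add: degree_linear_square)
  moreover have "degree (g1 * (?q * s1)) \<le> d + 2"
    using degree_mult_le[of ?q "g1 * s1"] * by (simp add: degree_linear_square ac_simps)
  ultimately show ?thesis
    unfolding interval_cert_def using True sos_mult_square[OF *(1)] sos_mult_square[OF *(2)]
    by (metis even_add even_numeral)
next
  case False
  let ?q = "[:a, 1::real:]\<^sup>2"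
  obtain s0 s1 where *: "sos s0" "sos s1" "degree s0 < d" "degree s1 < d"
      "h = [:1, -1:] * s0 + [:1, 1:] * s1"
    using assms False unfolding interval_cert_def by auto
  have "?q * h = [:1, -1:] * (?q * s0) + [:1, 1:] * (?q * s1)"
    using * by (simp only: algebra_simps)
  moreover have "degree (?q * s0) < d + 2" "degree (?q * s1) < d + 2"
    using degree_mult_le[of ?q s0] degree_mult_le[of ?q s1] *
    by (simp_all add: degree_linear_square)
  moreover have "odd (d + 2)"
    using False by simp
  ultimately show ?thesis
    unfolding interval_cert_def using sos_mult_square[OF *(1)] sos_mult_square[OF *(2)]
    by metis
qed

text \<open>The factor \<open>1 + c y\<close> either meets itself and becomes a square, which an
  s.o.s multiplier absorbs, or meets its conjugate \<open>1 - c y\<close> and becomes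
  \<open>g1\<close>. This exchanges the even and the odd form of the certificate.\<close>

lemma interval_cert_mult_linear:
  assumes "interval_cert d h" "c \<in> {1, -1}"
  shows "interval_cert (Suc d) ([:1, c:] * h)"
proof (cases "even d")
  case True
  let ?q = "[:1, c:]\<^sup>2"
  obtain s0 s1 where *: "sos s0" "sos s1" "degree s0 \<le> d" "degree (g1 * s1) \<le> d"
      "h = s0 + g1 * s1"
    using assms True unfolding interval_cert_def by auto
  \<comment> \<open>\<open>g1\<close> and \<open>?q\<close> both have degree 2, so the bound on
    \<open>g1 * s1\<close> transfers. The case \<open>s1 = 0\<close> is separate because the degree
    formula for products needs nonzero factors.\<close>
  have "degree (?q * s1) \<le> d"
  proof (cases "s1 = 0")
    case False
    then show ?thesis
      using degree_mult_le[of ?q s1] * degree_g1_mult[OF False] assms(2)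
      by (auto simp: degree_linear_square)
  qed simp
  moreover have "[:1, c:] * h = [:1, c:] * s0 + [:1, -c:] * (?q * s1)"
    using assms(2) unfolding *(5) g1_factor power2_eq_square
    by (auto simp only: algebra_simps insert_iff empty_iff minus_minus)
  moreover have "sos (?q * s1)"
    using * sos_mult_square by blast
  ultimately obtain u where u: "sos u" "degree u \<le> d"
      "[:1, c:] * h = [:1, c:] * s0 + [:1, -c:] * u"
    by blast
  have "\<exists>s0 s1. sos s0 \<and> sos s1 \<and> degree s0 < Suc d \<and> degree s1 < Suc d \<and>
       [:1, c:] * h = [:1, -1:] * s0 + [:1, 1:] * s1"
  proof (cases "c = 1")
    case True
    show ?thesis
      unfolding u(3) by (rule exI[of _ u], rule exI[of _ s0])
        (use u * True in \<open>simp del: mult_pCons_left\<close>)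
  next
    case False
    then have "c = -1" using assms(2) by simp
    show ?thesis
      unfolding u(3) by (rule exI[of _ s0], rule exI[of _ u])
        (use u * \<open>c = -1\<close> in \<open>simp del: mult_pCons_left\<close>)
  qed
  then show ?thesis
    unfolding interval_cert_def using True by simp
next
  case False
  obtain s0 s1 where *: "sos s0" "sos s1" "degree s0 < d" "degree s1 < d"
      "h = [:1, -1:] * s0 + [:1, 1:] * s1"
    using assms False unfolding interval_cert_def by auto
  \<comment> \<open>Relabelling the two multipliers according to the sign of \<open>c\<close> lets
    both endpoints be treated at once.\<close>
  obtain u v where uv: "sos u" "sos v" "degree u < d" "degree v < d"
      "h = [:1, c:] * u + [:1, -c:] * v"
    using * assms(2) by (auto simp del: mult_pCons_left simp: add.commute)
  let ?q = "[:1, c:]\<^sup>2"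
  have "[:1, c:] * h = ?q * u + g1 * v"
    using assms(2) unfolding uv(5) g1_factor power2_eq_square
    by (auto simp only: algebra_simps insert_iff empty_iff minus_minus)
  moreover have "degree (?q * u) \<le> Suc d"
    using degree_mult_le[of ?q u] uv assms(2) by (auto simp: degree_linear_square)
  moreover have "degree (g1 * v) \<le> Suc d"
    using degree_mult_le[of g1 v] uv by (simp add: g1_def)
  moreover have "even (Suc d)"
    using False by simp
  ultimately show ?thesis
    unfolding interval_cert_def using uv sos_mult_square[OF uv(1)] by metis
qed

text \<open>Dividing by a power of \<open>y - a\<close> loses the sign at \<open>a\<close> itself;
  continuity restores it.\<close>

lemma poly_nonneg_of_punctured:
  fixes h :: "real poly"
  assumes "-1 \<le> a" "a \<le> 1" "\<And>y. -1 \<le> y \<Longrightarrow> y \<le> 1 \<Longrightarrow> y \<noteq> a \<Longrightarrow> poly h y \<ge> 0"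
  shows "poly h a \<ge> 0"
proof (rule ccontr)
  assume "\<not> poly h a \<ge> 0"
  then have "poly h a < 0" by simp
  moreover have "isCont (poly h) a"
    by simp
  ultimately have "eventually (\<lambda>y. poly h y < 0) (nhds a)"
    by (metis continuous_within filterlim_at order_tendstoD(2) tendsto_at_iff_tendsto_nhds)
  then obtain e where e: "e > 0" "\<And>y. dist y a < e \<Longrightarrow> poly h y < 0"
    unfolding eventually_nhds_metric by auto
  \<comment> \<open>The step goes towards the far endpoint and has length at most 1, so
    \<open>z\<close> stays in the interval.\<close>
  define z where "z = (if a \<le> 0 then a + min (e/2) 1 else a - min (e/2) 1)"
  have "dist z a < e" "-1 \<le> z" "z \<le> 1" "z \<noteq> a"
    using e(1) assms(1,2) by (auto simp: z_def dist_real_def min_def)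
  then show False
    using e(2) assms(3) by fastforce
qed

text \<open>
  Subtract the minimum over \<open>[-1, 1]\<close> and divide by the factor belonging to the resulting root:
  a linear one at an endpoint, a square at an interior point.
\<close>

lemma interval_cert_of_nonneg:
  assumes "\<And>y. -1 \<le> y \<Longrightarrow> y \<le> 1 \<Longrightarrow> poly f y \<ge> 0" "degree f \<le> d"
  shows "interval_cert d f"
  using assms
proof (induction d arbitrary: f rule: less_induct)
  case (less d)
  have "\<exists>a\<in>{-1..1}. \<forall>y\<in>{-1..1}. poly f a \<le> poly f y"
    by (rule continuous_attains_inf) (auto intro!: continuous_intros)
  then obtain a where a: "-1 \<le> a" "a \<le> 1" "\<And>y. -1 \<le> y \<Longrightarrow> y \<le> 1 \<Longrightarrow> poly f a \<le> poly f y"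
    by auto
  define F where "F = f - [:poly f a:]"
  have F: "f = F + [:poly f a:]" "poly F a = 0" "degree F \<le> d"
    "\<And>y. -1 \<le> y \<Longrightarrow> y \<le> 1 \<Longrightarrow> poly F y \<ge> 0"
    using a less.prems(2) by (auto simp: F_def intro: degree_diff_le)
  have "interval_cert d F"
  proof (cases "F = 0")
    case True
    then show ?thesis
      using interval_cert_const[of 0 d] by simp
  next
    case False
    obtain h where h: "F = [:-a, 1:] * h"
      using F(2) unfolding poly_eq_0_iff_dvd by (elim dvdE)
    have dh: "degree F = Suc (degree h)" "h \<noteq> 0"
      using False unfolding h by (auto simp: degree_mult_eq simp del: mult_pCons_left)
    have polyF: "poly F y = (y - a) * poly h y" for y
      by (simp add: h algebra_simps)
    have hpos: "poly h y \<ge> 0" if "a < y" "y \<le> 1" for y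
      using F(4)[of y] that a(1) by (simp add: polyF zero_le_mult_iff)
    have hneg: "poly h y \<le> 0" if "-1 \<le> y" "y < a" for y
      using F(4)[of y] that a(2) by (simp add: polyF zero_le_mult_iff)
    \<comment> \<open>\<open>F\<close> is nonzero with a root, so its degree is positive and the
      bound can drop.\<close>
    obtain e where e: "d = Suc e"
      using dh F(3) by (cases d) auto
    consider "a = 1" | "a = -1" | "-1 < a" "a < 1"
      using a by linarith
    then show ?thesis
    proof cases
      case 1
      \<comment> \<open>At the right endpoint \<open>y - a\<close> is \<open>-(1 - y)\<close>, so
        the sign moves into the cofactor: \<open>F = (1 - y) * (-h)\<close>.\<close>
      have "poly (-h) y \<ge> 0" if "-1 \<le> y" "y \<le> 1" for y
      proof (cases "y = a")
        case True
        show ?thesis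
          unfolding True by (rule poly_nonneg_of_punctured) (use a hneg 1 in auto)
      qed (use hneg that 1 in auto)
      then have "interval_cert e (-h)"
        using dh F(3) e by (intro less.IH) auto
      from interval_cert_mult_linear[OF this, of "-1"] show ?thesis
        by (simp add: h e 1)
    next
      case 2
      have "poly h y \<ge> 0" if "-1 \<le> y" "y \<le> 1" for y
      proof (cases "y = a")
        case True
        show ?thesis
          unfolding True by (rule poly_nonneg_of_punctured) (use a hpos 2 in auto)
      qed (use hpos that 2 in auto)
      then have "interval_cert e h"
        using dh F(3) e by (intro less.IH) auto
      from interval_cert_mult_linear[OF this, of "1"] show ?thesis
        by (simp add: h e 2)
    next
      case 3
      \<comment> \<open>The cofactor is nonnegative to the right of \<open>a\<close> and nonpositive
        to the left. The two one-sided limits force it to vanish at \<open>a\<close>, which supplies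
        the second linear factor.\<close>
      have lim: "(poly h \<longlongrightarrow> poly h a) (at a within A)" for A
        by (intro tendsto_intros)
      have "poly h a \<ge> 0"
        by (rule tendsto_lowerbound[OF lim[of "{a<..}"]])
          (use 3 hpos in \<open>auto simp: eventually_at_right[of a 1]\<close>)
      moreover have "poly h a \<le> 0"
        by (rule tendsto_upperbound[OF lim[of "{..<a}"]])
          (use 3 hneg in \<open>auto simp: eventually_at_left[of "-1" a]\<close>)
      ultimately have "poly h a = 0"
        by simp
      then obtain k where k: "h = [:-a, 1:] * k"
        unfolding poly_eq_0_iff_dvd by (elim dvdE)
      have dk: "degree h = Suc (degree k)"
        using dh(2) unfolding k by (auto simp: degree_mult_eq simp del: mult_pCons_left)
      have polyk: "poly F y = (y - a)\<^sup>2 * poly k y" for y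
        by (simp add: h k algebra_simps power2_eq_square)
      have "poly k y \<ge> 0" if y: "-1 \<le> y" "y \<le> 1" "y \<noteq> a" for y
        using F(4)[of y] y by (simp add: polyk zero_le_mult_iff)
      then have "poly k y \<ge> 0" if "-1 \<le> y" "y \<le> 1" for y
        using poly_nonneg_of_punctured[OF a(1,2)] that by blast
      moreover have "degree k \<le> d - 2" "d - 2 + 2 = d" "d - 2 < d"
        using dh dk F(3) by auto
      ultimately have "interval_cert (d - 2) k"
        by (intro less.IH) auto
      then have "interval_cert (d - 2 + 2) ([:-a, 1:]\<^sup>2 * k)"
        by (rule interval_cert_mult_square)
      moreover have "F = [:-a, 1:]\<^sup>2 * k"
        unfolding h k power2_eq_square by (rule mult.assoc[symmetric])
      ultimately show ?thesis
        using \<open>d - 2 + 2 = d\<close> by argo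
    qed
  qed
  moreover have "interval_cert d [:poly f a:]"
    using less.prems(1) a(1,2) by (intro interval_cert_const) auto
  ultimately show ?case
    by (subst F(1)) (rule interval_cert_add)
qed

lemma qmodule_of_nonneg:
  assumes "\<And>y. y \<in> S \<Longrightarrow> poly f y \<ge> 0" "degree f \<le> 2 * t"
  shows "f \<in> qmodule t g1"
proof -
  have "interval_cert (2 * t) f"
    using assms by (intro interval_cert_of_nonneg) (auto simp: S_eq)
  then show ?thesis
    unfolding interval_cert_def qmodule_def by auto
qed

lemma qmodule_nonneg:
  assumes "f \<in> qmodule t g1" "y \<in> S"
  shows "poly f y \<ge> 0"
  using assms by (auto simp: qmodule_def S_def poly_sos_nonneg)

section \<open>Evaluation, degree and derivatives of polynomials\<close>

abbreviation "lookup \<equiv> Poly_Mapping.lookup"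
abbreviation "keys \<equiv> Poly_Mapping.keys"
abbreviation "single \<equiv> Poly_Mapping.single"

lemma poly_mapping_sum_single:
  fixes f :: "'k \<Rightarrow>\<^sub>0 'b::comm_monoid_add"
  shows "f = (\<Sum>a\<in>keys f. single a (lookup f a))"
  by (rule poly_mapping_eqI)
    (auto simp: lookup_sum lookup_single when_def in_keys_iff sum.If_cases)

text \<open>Identities additive in \<open>f\<close> reduce to monomials, and the addition step needs
  no disjointness of supports.\<close>

lemma poly_mapping_additive_induct [case_names zero single add]:
  fixes f :: "'k \<Rightarrow>\<^sub>0 'b::comm_monoid_add"
  assumes "P 0" "\<And>a c. P (single a c)" "\<And>f g. P f \<Longrightarrow> P g \<Longrightarrow> P (f + g)"
  shows "P f"
proof -
  have "P (\<Sum>a\<in>A. single a (lookup f a))" if "finite A" for A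
    using that by (induction A) (auto intro: assms)
  from this[OF finite_keys[of f]] show ?thesis
    using poly_mapping_sum_single[of f] by metis
qed

section \<open>Evaluation of polynomials in a commutative ring\<close>

definition monom_at :: "('i::finite \<Rightarrow> 'b::comm_semiring_1) \<Rightarrow> ('i \<Rightarrow>\<^sub>0 nat) \<Rightarrow> 'b" where
  "monom_at v a = (\<Prod>i\<in>UNIV. v i ^ lookup a i)"

lemma monom_at_zero [simp]: "monom_at v 0 = 1"
  by (simp add: monom_at_def)

lemma monom_at_add: "monom_at v (a + b) = monom_at v a * monom_at v b"
  by (simp add: monom_at_def lookup_add power_add prod.distrib)

lemma monom_at_single: "monom_at v (single i n) = v i ^ n"
proof -
  have "monom_at v (single i n) = (\<Prod>j\<in>UNIV. if j = i then v i ^ n else 1)"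
    unfolding monom_at_def by (rule prod.cong) (auto simp: lookup_single when_def)
  then show ?thesis
    by simp
qed

text \<open>Target ring and coefficient map are parameters because two instances are needed:
  insertion of a real point, and substitution of polynomials for the variables.\<close>

definition eval_mpoly ::
  "(real \<Rightarrow> 'b::comm_ring_1) \<Rightarrow> ('i::finite \<Rightarrow> 'b) \<Rightarrow> ('i, real) mpoly \<Rightarrow> 'b" where
  "eval_mpoly \<phi> v f = (\<Sum>a\<in>keys f. \<phi> (lookup f a) * monom_at v a)"

locale coeff_hom =
  fixes \<phi> :: "real \<Rightarrow> 'b::comm_ring_1"
  assumes hom_add: "\<phi> (a + b) = \<phi> a + \<phi> b"
    and hom_mult: "\<phi> (a * b) = \<phi> a * \<phi> b"
    and hom_one: "\<phi> 1 = 1"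
begin

lemma hom_zero: "\<phi> 0 = 0"
  using hom_add[of 0 0] by simp

lemma eval_superset:
  assumes "finite A" "keys f \<subseteq> A"
  shows "eval_mpoly \<phi> v f = (\<Sum>a\<in>A. \<phi> (lookup f a) * monom_at v a)"
  unfolding eval_mpoly_def
  by (rule sum.mono_neutral_left) (use assms in \<open>auto simp: in_keys_iff hom_zero\<close>)

lemma eval_zero [simp]: "eval_mpoly \<phi> v 0 = 0"
  by (simp add: eval_mpoly_def)

lemma eval_add: "eval_mpoly \<phi> v (f + g) = eval_mpoly \<phi> v f + eval_mpoly \<phi> v g"
proof -
  let ?A = "keys f \<union> keys g"
  have "eval_mpoly \<phi> v (f + g) = (\<Sum>a\<in>?A. \<phi> (lookup (f + g) a) * monom_at v a)"
    by (rule eval_superset) (simp_all add: keys_add)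
  also have "\<dots> = (\<Sum>a\<in>?A. \<phi> (lookup f a) * monom_at v a) + (\<Sum>a\<in>?A. \<phi> (lookup g a) * monom_at v a)"
    by (simp add: lookup_add hom_add distrib_right sum.distrib)
  also have "\<dots> = eval_mpoly \<phi> v f + eval_mpoly \<phi> v g"
    by (simp add: eval_superset[of ?A])
  finally show ?thesis .
qed

lemma eval_sum: "eval_mpoly \<phi> v (\<Sum>l\<in>A. f l) = (\<Sum>l\<in>A. eval_mpoly \<phi> v (f l))"
  by (induction A rule: infinite_finite_induct) (simp_all add: eval_add)

lemma eval_single: "eval_mpoly \<phi> v (single a c) = \<phi> c * monom_at v a"
  by (simp add: eval_mpoly_def hom_zero)

lemma eval_mult: "eval_mpoly \<phi> v (f * g) = eval_mpoly \<phi> v f * eval_mpoly \<phi> v g"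
proof (induction f rule: poly_mapping_additive_induct)
  case (single a c)
  show ?case
    by (induction g rule: poly_mapping_additive_induct)
      (simp_all add: mult_single eval_single eval_add hom_mult monom_at_add algebra_simps)
qed (simp_all add: eval_add distrib_right)

lemma eval_one: "eval_mpoly \<phi> v 1 = 1"
  using eval_single[of v 0 1] by (simp add: hom_one)

lemma eval_power: "eval_mpoly \<phi> v (f ^ n) = eval_mpoly \<phi> v f ^ n"
  by (induction n) (simp_all add: eval_one eval_mult)

lemma eval_Const: "eval_mpoly \<phi> v (Const c) = \<phi> c"
  by (simp add: Const_def eval_single)

lemma eval_Var: "eval_mpoly \<phi> v (Var i) = v i"
  by (simp add: Var_def mono_of_def eval_single monom_at_single hom_one)

end

lemma Const_add: "Const (a + b) = Const a + Const b"
  by (simp add: Const_def single_add)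

lemma Const_mult: "Const (a * b) = Const a * Const b"
  by (simp add: Const_def mult_single)

lemma Const_one: "Const 1 = 1"
  by (simp add: Const_def)

lemma Const_power: "Const c ^ n = Const (c ^ n)"
  by (induction n) (simp_all add: Const_mult Const_one)

lemma Const_zero: "Const 0 = 0"
  by (simp add: Const_def)

lemma Const_mult_single: "Const c * single a d = single a (c * d)"
  by (simp add: Const_def mult_single)

lemma lookup_Const_mult: "lookup (Const c * f) a = c * lookup f a"
  by (induction f rule: poly_mapping_additive_induct)
    (simp_all add: Const_mult_single lookup_single lookup_add distrib_left when_def)

interpretation point: coeff_hom "\<lambda>c::real. c"
  by unfold_locales simp_all

interpretation subst: coeff_hom "Const :: real \<Rightarrow> ('i, real) mpoly"
  by unfold_locales (simp_all add: Const_add Const_mult Const_one)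

lemma insertion_eq_eval: "insertion f x = eval_mpoly (\<lambda>c. c) (\<lambda>i. x $ i) f"
  by (simp add: insertion_def eval_mpoly_def monom_at_def)

lemma Var_power: "Var i ^ n = single (single i n) 1"
  by (induction n) (simp_all add: Var_def mono_of_def mult_single flip: single_add)

lemma monom_at_Var: "monom_at Var a = mono_of a"
proof (rule poly_mapping_eqI)
  fix b
  have "monom_at Var a = (\<Prod>i\<in>UNIV. single (single i (lookup a i)) (1::real))"
    by (simp add: monom_at_def Var_power)
  also have "(\<Prod>i\<in>A. single (single i (lookup a i)) (1::real)) = single (\<Sum>i\<in>A. single i (lookup a i)) 1"
    if "finite A" for A
    using that by induction (simp_all add: mult_single)
  then have "(\<Prod>i\<in>UNIV. single (single i (lookup a i)) (1::real)) = single (\<Sum>i\<in>UNIV. single i (lookup a i)) 1"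
    by simp
  also have "(\<Sum>i\<in>UNIV. single i (lookup a i)) = a"
    by (rule poly_mapping_eqI) (simp add: lookup_sum lookup_single when_def)
  finally show "lookup (monom_at Var a) b = lookup (mono_of a) b"
    by (simp add: mono_of_def)
qed

text \<open>Together with \<open>eval_at_Const\<close> this identifies the endpoints of the segment
  in Jensen's inequality: \<open>h\<close> itself at one end, the constant \<open>h(x)\<close> at
  the other.\<close>

lemma eval_at_Var: "eval_mpoly Const Var f = f"
proof -
  have "eval_mpoly Const Var f = (\<Sum>a\<in>keys f. single a (lookup f a))"
    by (simp add: eval_mpoly_def monom_at_Var mono_of_def Const_mult_single)
  then show ?thesis
    using poly_mapping_sum_single[of f] by metis
qed

lemma monom_at_Const: "monom_at (\<lambda>i. Const (x $ i)) a = Const (monom_at (\<lambda>i. x $ i) a)"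
proof -
  have "(\<Prod>i\<in>A. Const (x $ i) ^ lookup a i) = Const (\<Prod>i\<in>A. x $ i ^ lookup a i)" for A
    by (induction A rule: infinite_finite_induct) (simp_all add: Const_mult Const_one Const_power)
  then show ?thesis
    by (simp add: monom_at_def)
qed

lemma eval_at_Const: "eval_mpoly Const (\<lambda>i. Const (x $ i)) f = Const (insertion f x)"
  unfolding insertion_eq_eval
  by (induction f rule: poly_mapping_additive_induct)
    (simp_all add: Const_zero Const_add Const_mult subst.eval_add point.eval_add
      subst.eval_single point.eval_single monom_at_Const)

section \<open>Total degree\<close>

lemma mdeg_zero [simp]: "mdeg 0 = 0"
  by (simp add: mdeg_def)

lemma mdeg_add: "mdeg (a + b) = mdeg a + mdeg b"
  by (simp add: mdeg_def lookup_add sum.distrib)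

lemma mdeg_single [simp]: "mdeg (single i n) = n"
  by (simp add: mdeg_def lookup_single when_def)

lemma mdeg_eq_0_iff: "mdeg a = 0 \<longleftrightarrow> a = 0"
  by (auto simp: mdeg_def poly_mapping_eq_iff fun_eq_iff)

lemma finite_mdeg_le: "finite {a. mdeg (a :: 'm::finite \<Rightarrow>\<^sub>0 nat) \<le> k}"
proof (rule finite_imageD)
  have "lookup a i \<le> mdeg a" for a :: "'m \<Rightarrow>\<^sub>0 nat" and i
    unfolding mdeg_def by (rule member_le_sum) auto
  then have "lookup ` {a. mdeg (a :: 'm \<Rightarrow>\<^sub>0 nat) \<le> k} \<subseteq> (UNIV \<rightarrow>\<^sub>E {..k})"
    by (auto simp: PiE_def Pi_def intro: order_trans)
  then show "finite (lookup ` {a. mdeg (a :: 'm \<Rightarrow>\<^sub>0 nat) \<le> k})"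
    by (rule finite_subset) (simp add: finite_PiE)
  show "inj_on lookup {a. mdeg (a :: 'm \<Rightarrow>\<^sub>0 nat) \<le> k}"
    by (rule inj_onI) (simp add: lookup_inject)
qed

lemma polys_le_mono: "j \<le> k \<Longrightarrow> f \<in> polys_le j \<Longrightarrow> f \<in> polys_le k"
  by (fastforce simp: polys_le_def)

lemma polys_le_zero [simp]: "0 \<in> polys_le k"
  by (simp add: polys_le_def)

lemma polys_le_one [simp]: "1 \<in> polys_le k"
  by (simp add: polys_le_def)

lemma polys_le_single: "mdeg a \<le> k \<Longrightarrow> single a c \<in> polys_le k"
  by (simp add: polys_le_def)

lemma polys_le_Const [simp]: "Const c \<in> polys_le k"
  by (simp add: Const_def polys_le_single)

lemma polys_le_Var: "1 \<le> k \<Longrightarrow> Var i \<in> polys_le k"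
  unfolding Var_def mono_of_def by (rule polys_le_single) simp

lemma polys_le_add: "f \<in> polys_le k \<Longrightarrow> g \<in> polys_le k \<Longrightarrow> f + g \<in> polys_le k"
  using keys_add[of f g] by (auto simp: polys_le_def)

lemma polys_le_sum: "(\<And>l. l \<in> A \<Longrightarrow> f l \<in> polys_le k) \<Longrightarrow> (\<Sum>l\<in>A. f l) \<in> polys_le k"
  by (induction A rule: infinite_finite_induct) (simp_all add: polys_le_add)

lemma polys_le_uminus: "f \<in> polys_le k \<Longrightarrow> - f \<in> polys_le k"
  by (auto simp: polys_le_def in_keys_iff)

lemma polys_le_diff: "f \<in> polys_le k \<Longrightarrow> g \<in> polys_le k \<Longrightarrow> f - g \<in> polys_le k"
  using polys_le_add[of f k "- g"] polys_le_uminus[of g k] by simp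

lemma polys_le_mult:
  assumes "f \<in> polys_le j" "g \<in> polys_le k"
  shows "f * g \<in> polys_le (j + k)"
  unfolding polys_le_def
proof safe
  fix a assume "a \<in> keys (f * g)"
  then obtain b c where "a = b + c" "b \<in> keys f" "c \<in> keys g"
    using keys_mult[of f g] by auto
  then show "mdeg a \<le> j + k"
    using assms by (auto simp: polys_le_def mdeg_add add_mono)
qed

lemma polys_le_power: "f \<in> polys_le k \<Longrightarrow> f ^ n \<in> polys_le (n * k)"
  by (induction n) (simp_all add: polys_le_mult)

lemma polys_le_square: "f \<in> polys_le k \<Longrightarrow> f\<^sup>2 \<in> polys_le (2 * k)"
  by (rule polys_le_power)

lemma polys_le_prod:
  "(\<And>i. i \<in> A \<Longrightarrow> f i \<in> polys_le (k i)) \<Longrightarrow> (\<Prod>i\<in>A. f i) \<in> polys_le (\<Sum>i\<in>A. k i)"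
  by (induction A rule: infinite_finite_induct) (simp_all add: polys_le_mult)

lemma polys_le_Const_mult: "f \<in> polys_le k \<Longrightarrow> Const c * f \<in> polys_le k"
  using polys_le_mult[OF polys_le_Const[of c 0]] by simp

text \<open>Affine substitutions do not raise the degree, so the whole segment stays in the domain
  of \<open>L\<close>.\<close>

lemma polys_le_eval:
  assumes "\<And>i. v i \<in> polys_le 1" "f \<in> polys_le k"
  shows "eval_mpoly Const v f \<in> polys_le k"
  unfolding eval_mpoly_def
proof (intro polys_le_sum polys_le_Const_mult)
  fix a assume "a \<in> keys f"
  have "monom_at v a \<in> polys_le (mdeg a)"
    unfolding monom_at_def mdeg_def
    by (rule polys_le_prod) (use polys_le_power[OF assms(1)] in simp)
  then show "monom_at v a \<in> polys_le k"
    by (rule polys_le_mono[rotated]) (use assms(2) \<open>a \<in> keys f\<close> in \<open>simp add: polys_le_def\<close>)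
qed

section \<open>Formal partial derivatives\<close>

lemma pdiff_superset:
  assumes "finite A" "keys f \<subseteq> A"
  shows "pdiff i f = (\<Sum>a\<in>A. single (a - single i 1) (real (lookup a i) * lookup f a))"
  unfolding pdiff_def
  by (rule sum.mono_neutral_left) (use assms in \<open>auto simp: in_keys_iff\<close>)

lemma pdiff_zero [simp]: "pdiff i 0 = 0"
  by (simp add: pdiff_def)

lemma pdiff_single: "pdiff i (single a c) = single (a - single i 1) (real (lookup a i) * c)"
  by (simp add: pdiff_def)

lemma pdiff_add: "pdiff i (f + g) = pdiff i f + pdiff i g"
proof -
  let ?A = "keys f \<union> keys g"
  have "pdiff i (f + g) =
      (\<Sum>a\<in>?A. single (a - single i 1) (real (lookup a i) * lookup (f + g) a))"
    by (rule pdiff_superset) (simp_all add: keys_add)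
  also have "\<dots> = (\<Sum>a\<in>?A. single (a - single i 1) (real (lookup a i) * lookup f a)) +
      (\<Sum>a\<in>?A. single (a - single i 1) (real (lookup a i) * lookup g a))"
    by (simp add: lookup_add distrib_left single_add sum.distrib)
  also have "\<dots> = pdiff i f + pdiff i g"
    by (simp add: pdiff_superset[of ?A])
  finally show ?thesis .
qed

lemma exponent_decr:
  fixes a :: "'i \<Rightarrow>\<^sub>0 nat"
  assumes "lookup a i \<noteq> 0"
  shows "(a - single i 1) + single i 1 = a"
  by (rule poly_mapping_eqI)
    (use assms in \<open>auto simp: lookup_add lookup_minus lookup_single when_def\<close>)

lemma polys_le_pdiff:
  assumes "f \<in> polys_le k"
  shows "pdiff i f \<in> polys_le (k - 1)"
  unfolding pdiff_def
proof (rule polys_le_sum)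
  fix a assume a: "a \<in> keys f"
  show "single (a - single i 1) (real (lookup a i) * lookup f a) \<in> polys_le (k - 1)"
  proof (cases "lookup a i = 0")
    case False
    have "mdeg (a - single i 1) + 1 = mdeg a"
      using mdeg_add[of "a - single i 1" "single i 1"] exponent_decr[OF False] by simp
    moreover have "mdeg a \<le> k"
      using a assms by (simp add: polys_le_def)
    ultimately show ?thesis
      by (intro polys_le_single) simp
  qed simp
qed

text \<open>
  Coefficientwise derivative at \<open>s\<close> of a curve of polynomials; linear functionals on
  polynomials of bounded degree commute with it.
\<close>

definition has_coeff_deriv ::
  "(real \<Rightarrow> ('m::finite, real) mpoly) \<Rightarrow> ('m, real) mpoly \<Rightarrow> real \<Rightarrow> bool" where
  "has_coeff_deriv F F' s \<longleftrightarrow>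
    (\<forall>a. ((\<lambda>t. lookup (F t) a) has_real_derivative lookup F' a) (at s))"

text \<open>Needed because a sum over an infinite index set is 0 by convention.\<close>

lemma finite_exponent_pairs: "finite {(b, c). b + c = (a :: 'm::finite \<Rightarrow>\<^sub>0 nat)}"
  by (rule finite_subset[of _ "{b. mdeg b \<le> mdeg a} \<times> {b. mdeg b \<le> mdeg a}"])
    (auto simp: mdeg_add finite_mdeg_le)

text \<open>The index set depends on \<open>a\<close> alone and not on the supports of the factors.
  So the formula can be differentiated termwise when the factors vary with a parameter.\<close>

lemma lookup_mult_sum:
  fixes f g :: "('m::finite, real) mpoly"
  shows "lookup (f * g) a =
    (\<Sum>(b, c)\<in>{(b, c). b + c = a}. lookup f b * lookup g c)"
proof (induction f rule: poly_mapping_additive_induct)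
  case (single b0 x)
  show ?case
  proof (induction g rule: poly_mapping_additive_induct)
    case (single c0 y)
    have "(\<Sum>(b, c)\<in>{(b, c). b + c = a}. lookup (single b0 x) b * lookup (single c0 y) c) =
        (\<Sum>z\<in>{(b, c). b + c = a}. if z = (b0, c0) then x * y else 0)"
      by (rule sum.cong) (auto simp: lookup_single when_def split: if_splits)
    also have "\<dots> = lookup (single b0 x * single c0 y) a"
      using finite_exponent_pairs[of a] by (simp add: mult_single lookup_single when_def)
    finally show ?case by simp
  qed (simp_all add: distrib_left lookup_add case_prod_unfold sum.distrib)
qed (simp_all add: distrib_right lookup_add case_prod_unfold sum.distrib)

lemma has_coeff_deriv_const: "has_coeff_deriv (\<lambda>t. f) 0 s"
  by (simp add: has_coeff_deriv_def)

lemma has_coeff_deriv_add: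
  assumes "has_coeff_deriv F F' s" "has_coeff_deriv G G' s"
  shows "has_coeff_deriv (\<lambda>t. F t + G t) (F' + G') s"
  using assms unfolding has_coeff_deriv_def lookup_add by (metis DERIV_add)

lemma has_coeff_deriv_sum:
  assumes "\<And>l. l \<in> A \<Longrightarrow> has_coeff_deriv (F l) (F' l) s"
  shows "has_coeff_deriv (\<lambda>t. \<Sum>l\<in>A. F l t) (\<Sum>l\<in>A. F' l) s"
  using assms
  by (induction A rule: infinite_finite_induct)
    (auto simp: has_coeff_deriv_const intro: has_coeff_deriv_add)

lemma has_coeff_deriv_mult:
  assumes "has_coeff_deriv F F' s" "has_coeff_deriv G G' s"
  shows "has_coeff_deriv (\<lambda>t. F t * G t) (F' * G s + F s * G') s"
  unfolding has_coeff_deriv_def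
proof
  fix a
  have "((\<lambda>t. \<Sum>(b, c)\<in>{(b, c). b + c = a}. lookup (F t) b * lookup (G t) c) has_real_derivative
      (\<Sum>(b, c)\<in>{(b, c). b + c = a}. lookup F' b * lookup (G s) c + lookup (F s) b * lookup G' c)) (at s)"
    unfolding case_prod_unfold
    by (rule DERIV_sum, rule derivative_eq_intros)
      (use assms in \<open>auto simp: has_coeff_deriv_def\<close>)
  then show "((\<lambda>t. lookup (F t * G t) a) has_real_derivative
      lookup (F' * G s + F s * G') a) (at s)"
    by (simp add: lookup_mult_sum lookup_add case_prod_unfold sum.distrib)
qed

lemma has_coeff_deriv_power:
  assumes "has_coeff_deriv F F' s"
  shows "has_coeff_deriv (\<lambda>t. F t ^ n) (of_nat n * F s ^ (n - 1) * F') s"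
proof (induction n)
  case 0
  then show ?case by (simp add: has_coeff_deriv_const)
next
  case (Suc n)
  from has_coeff_deriv_mult[OF assms Suc]
  show ?case
    by (cases n) (simp_all add: algebra_simps)
qed

lemma has_coeff_deriv_prod:
  assumes "finite A" "\<And>i. i \<in> A \<Longrightarrow> has_coeff_deriv (F i) (F' i) s"
  shows "has_coeff_deriv (\<lambda>t. \<Prod>i\<in>A. F i t) (\<Sum>i\<in>A. F' i * (\<Prod>j\<in>A - {i}. F j s)) s"
  using assms
proof (induction A)
  case empty
  then show ?case by (simp add: has_coeff_deriv_const)
next
  case (insert k A)
  have "(\<Sum>i\<in>A. F' i * (\<Prod>j\<in>insert k A - {i}. F j s)) =
      F k s * (\<Sum>i\<in>A. F' i * (\<Prod>j\<in>A - {i}. F j s))"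
    unfolding sum_distrib_left
  proof (rule sum.cong)
    fix i assume "i \<in> A"
    then have "insert k A - {i} = insert k (A - {i})" "k \<notin> A - {i}"
      using insert.hyps by auto
    then show "F' i * (\<Prod>j\<in>insert k A - {i}. F j s) = F k s * (F' i * (\<Prod>j\<in>A - {i}. F j s))"
      using insert.hyps by (simp add: algebra_simps)
  qed simp
  then show ?case
    using has_coeff_deriv_mult[OF insert.prems[of k] insert.IH] insert.hyps insert.prems
    by simp
qed

text \<open>The chain rule, which links the formal \<open>pdiff\<close> to differentiation in the
  curve parameter; by additivity only monomials need the product and power rules.\<close>

lemma has_coeff_deriv_eval:
  assumes "\<And>i. has_coeff_deriv (\<lambda>t. v t i) (w i) s"
  shows "has_coeff_deriv (\<lambda>t. eval_mpoly Const (v t) f)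
    (\<Sum>j\<in>UNIV. eval_mpoly Const (v s) (pdiff j f) * w j) s"
proof (induction f rule: poly_mapping_additive_induct)
  case zero
  then show ?case by (simp add: has_coeff_deriv_const)
next
  case (add f g)
  then show ?case
    using has_coeff_deriv_add[OF add]
    by (simp add: subst.eval_add pdiff_add distrib_right sum.distrib)
next
  case (single a c)
  \<comment> \<open>Truncated subtraction in \<open>pdiff\<close> matches the exponent
    \<open>n - 1\<close> of the power rule, also where the exponent is 0.\<close>
  have mono: "of_nat (lookup a j) * monom_at (v s) (a - single j 1) =
      of_nat (lookup a j) * v s j ^ (lookup a j - 1) * (\<Prod>i\<in>UNIV - {j}. v s i ^ lookup a i)" for j
  proof -
    have "monom_at (v s) (a - single j 1) =
        v s j ^ (lookup a j - 1) * (\<Prod>i\<in>UNIV - {j}. v s i ^ lookup (a - single j 1) i)"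
      unfolding monom_at_def by (subst prod.remove[of _ j]) (simp_all add: lookup_minus)
    also have "(\<Prod>i\<in>UNIV - {j}. v s i ^ lookup (a - single j 1) i) =
        (\<Prod>i\<in>UNIV - {j}. v s i ^ lookup a i)"
      by (rule prod.cong) (auto simp: lookup_minus lookup_single when_def)
    finally show ?thesis
      by (simp add: mult.assoc)
  qed
  have of_nat: "Const (real n) = of_nat n" for n
    by (simp add: Const_def)
  have "has_coeff_deriv (\<lambda>t. Const c * monom_at (v t) a)
    (0 * monom_at (v s) a + Const c * (\<Sum>j\<in>UNIV. of_nat (lookup a j) * v s j ^ (lookup a j - 1) * w j *
      (\<Prod>i\<in>UNIV - {j}. v s i ^ lookup a i))) s"
    unfolding monom_at_def
    by (intro has_coeff_deriv_mult has_coeff_deriv_const has_coeff_deriv_prod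
        has_coeff_deriv_power assms) simp
  also have "0 * monom_at (v s) a + Const c * (\<Sum>j\<in>UNIV. of_nat (lookup a j) * v s j ^ (lookup a j - 1) * w j *
      (\<Prod>i\<in>UNIV - {j}. v s i ^ lookup a i)) =
     (\<Sum>j\<in>UNIV. Const c * (of_nat (lookup a j) * monom_at (v s) (a - single j 1)) * w j)"
    unfolding mono by (simp add: sum_distrib_left mult_ac)
  also have "\<dots> = (\<Sum>j\<in>UNIV. eval_mpoly Const (v s) (pdiff j (single a c)) * w j)"
    by (simp add: pdiff_single subst.eval_single Const_mult of_nat mult_ac)
  finally show ?case
    by (simp add: subst.eval_single)
qed

section \<open>Sums of squares and Jensen's inequality\<close>

text \<open>
  A strictly convex function, here the squared norm, singles out an exponent of maximal degree
  that is not the midpoint of two others; the square of its coefficient cannot cancel in a sum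
  of squares.
\<close>

lemma extremal_exponent:
  fixes E :: "('m::finite \<Rightarrow>\<^sub>0 nat) set"
  assumes "finite E" "a0 \<in> E"
  obtains a where "a \<in> E" "mdeg a0 \<le> mdeg a"
    "\<And>b c. b \<in> E \<Longrightarrow> c \<in> E \<Longrightarrow> b + c = a + a \<Longrightarrow> b = a \<and> c = a"
proof -
  define D where "D = Max (mdeg ` E)"
  have D: "mdeg b \<le> D" if "b \<in> E" for b
    unfolding D_def using assms(1) that by simp
  define E' where "E' = {b \<in> E. mdeg b = D}"
  define q where "q b = (\<Sum>i\<in>UNIV. (int (lookup b i))\<^sup>2)" for b :: "'m \<Rightarrow>\<^sub>0 nat"
  have "D \<in> mdeg ` E"
    unfolding D_def using assms by (intro Max_in) auto
  then have "finite E'" "E' \<noteq> {}"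
    using assms(1) by (auto simp: E'_def)
  then have "Max (q ` E') \<in> q ` E'"
    by (intro Max_in) auto
  then obtain a where a: "a \<in> E'" "q a = Max (q ` E')"
    by auto
  have qa: "q b \<le> q a" if "b \<in> E'" for b
    unfolding a(2) using that \<open>finite E'\<close> by simp
  have "b = a \<and> c = a" if bc: "b \<in> E" "c \<in> E" "b + c = a + a" for b c
  proof -
    have "mdeg b + mdeg c = mdeg a + mdeg a"
      using bc(3) by (metis mdeg_add)
    then have "b \<in> E'" "c \<in> E'"
      using bc D[of b] D[of c] a(1) by (auto simp: E'_def)
    have sum: "lookup b i + lookup c i = 2 * lookup a i" for i
      using bc(3) by (metis lookup_add mult_2)
    \<comment> \<open>The parallelogram law coordinatewise, with \<open>b + c\<close> replaced by
      \<open>2 a\<close>. Summed up, maximality of \<open>q a\<close> makes the squared distance of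
      \<open>b\<close> and \<open>c\<close> nonpositive.\<close>
    have "(int (lookup b i) - int (lookup c i))\<^sup>2 =
        2 * (int (lookup b i))\<^sup>2 + 2 * (int (lookup c i))\<^sup>2 - 4 * (int (lookup a i))\<^sup>2" for i
    proof -
      have c: "int (lookup c i) = 2 * int (lookup a i) - int (lookup b i)"
        using sum[of i] by linarith
      show ?thesis
        unfolding c by (simp add: power2_eq_square algebra_simps)
    qed
    then have "(\<Sum>i\<in>UNIV. (int (lookup b i) - int (lookup c i))\<^sup>2) = 2 * q b + 2 * q c - 4 * q a"
      by (simp add: q_def sum.distrib sum_subtractf sum_distrib_left)
    also have "\<dots> \<le> 0"
      using qa[OF \<open>b \<in> E'\<close>] qa[OF \<open>c \<in> E'\<close>] by simp
    finally have "(\<Sum>i\<in>UNIV. (int (lookup b i) - int (lookup c i))\<^sup>2) = 0"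
      by (intro antisym sum_nonneg) auto
    then have "lookup b i = lookup c i" for i
      by (simp add: sum_nonneg_eq_0_iff)
    then have "lookup b i = lookup a i" "lookup c i = lookup a i" for i
      using sum[of i] by simp_all
    then show ?thesis
      by (auto intro: poly_mapping_eqI)
  qed
  then show ?thesis
    using that[of a] a(1) D[OF assms(2)] by (auto simp: E'_def)
qed

text \<open>At twice an extremal exponent each square contributes only the square of one
  coefficient, so the sum has a positive coefficient there. This bounds the entries of the Hessian
  factor, whose degree \<open>sos_convex\<close> leaves open.\<close>

lemma polys_le_of_sum_squares:
  fixes H :: "'l \<Rightarrow> ('m::finite, real) mpoly"
  assumes "finite A" "(\<Sum>l\<in>A. H l * H l) \<in> polys_le (2 * n)" "k \<in> A"
  shows "H k \<in> polys_le n"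
proof (rule ccontr)
  assume "H k \<notin> polys_le n"
  then obtain a0 where a0: "a0 \<in> keys (H k)" "mdeg a0 > n"
    by (auto simp: polys_le_def not_le)
  \<comment> \<open>The union over all summands provides one exponent that is extremal for every
    \<open>H l\<close> at once.\<close>
  define E where "E = (\<Union>l\<in>A. keys (H l))"
  have "finite E" "a0 \<in> E"
    using assms a0 by (auto simp: E_def)
  then obtain a where a: "a \<in> E" "mdeg a0 \<le> mdeg a"
    "\<And>b c. b \<in> E \<Longrightarrow> c \<in> E \<Longrightarrow> b + c = a + a \<Longrightarrow> b = a \<and> c = a"
    by (rule extremal_exponent) blast
  have coeff: "lookup (H l * H l) (a + a) = (lookup (H l) a)\<^sup>2" if "l \<in> A" for l
  proof -
    have "lookup (H l * H l) (a + a) =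
        (\<Sum>z\<in>{(b, c). b + c = a + a}. if z = (a, a) then (lookup (H l) a)\<^sup>2 else 0)"
      unfolding lookup_mult_sum
    proof (rule sum.cong[OF refl])
      fix z assume "z \<in> {(b, c). b + c = a + a}"
      then obtain b c where z: "z = (b, c)" "b + c = a + a"
        by auto
      have eq: "b = a \<and> c = a" if "lookup (H l) b \<noteq> 0" "lookup (H l) c \<noteq> 0"
      proof (rule a(3)[OF _ _ z(2)])
        show "b \<in> E" "c \<in> E"
          using that \<open>l \<in> A\<close> by (auto simp: E_def in_keys_iff)
      qed
      show "(case z of (b, c) \<Rightarrow> lookup (H l) b * lookup (H l) c) =
          (if z = (a, a) then (lookup (H l) a)\<^sup>2 else 0)"
      proof (cases "z = (a, a)")
        case True
        then show ?thesis
          by (simp add: power2_eq_square)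
      next
        case False
        then have "lookup (H l) b = 0 \<or> lookup (H l) c = 0"
          using eq z(1) by blast
        then show ?thesis
          using False z(1) by auto
      qed
    qed
    then show ?thesis
      using finite_exponent_pairs[of "a + a"] by simp
  qed
  obtain l where "l \<in> A" "lookup (H l) a \<noteq> 0"
    using a(1) by (auto simp: E_def in_keys_iff)
  then have "(\<Sum>l\<in>A. (lookup (H l) a)\<^sup>2) > 0"
    using assms(1) by (intro sum_pos2[of A l]) auto
  then have "a + a \<in> keys (\<Sum>l\<in>A. H l * H l)"
    by (simp add: in_keys_iff lookup_sum coeff)
  then show False
    using assms(2) a(2) a0(2) by (fastforce simp: polys_le_def mdeg_add)
qed

section \<open>Truncated linear functionals\<close>

lemma dual_add: "L \<in> dual k \<Longrightarrow> f \<in> polys_le k \<Longrightarrow> g \<in> polys_le k \<Longrightarrow> L (f + g) = L f + L g"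
  by (simp add: dual_def)

lemma dual_Const_mult: "L \<in> dual k \<Longrightarrow> f \<in> polys_le k \<Longrightarrow> L (Const c * f) = c * L f"
  by (simp add: dual_def)

lemma dual_zero: "L \<in> dual k \<Longrightarrow> L 0 = 0"
  using dual_Const_mult[of L k 0 0] by simp

lemma dual_Const: "L \<in> dual k \<Longrightarrow> L (Const c) = c * L 1"
  using dual_Const_mult[of L k 1 c] by simp

lemma dual_sum:
  assumes "L \<in> dual k" "\<And>l. l \<in> A \<Longrightarrow> f l \<in> polys_le k"
  shows "L (\<Sum>l\<in>A. f l) = (\<Sum>l\<in>A. L (f l))"
  using assms(2)
  by (induction A rule: infinite_finite_induct)
    (simp_all add: dual_zero[OF assms(1)] dual_add[OF assms(1)] polys_le_sum)

text \<open>The set \<open>A\<close> is left free: the support of one polynomial when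
  \<open>L\<close> is applied to \<open>p\<close>, all exponents of bounded degree when the
  polynomial moves along a curve.\<close>

lemma dual_expand:
  fixes f :: "('m::finite, real) mpoly"
  assumes "L \<in> dual k" "finite A" "keys f \<subseteq> A" "\<And>a. a \<in> A \<Longrightarrow> mdeg a \<le> k"
  shows "L f = (\<Sum>a\<in>A. lookup f a * L (mono_of a))"
proof -
  have le: "mono_of a \<in> polys_le k" if "a \<in> A" for a
    using assms(4)[OF that] by (simp add: mono_of_def polys_le_single)
  have "f = (\<Sum>a\<in>keys f. single a (lookup f a))"
    by (rule poly_mapping_sum_single)
  also have "\<dots> = (\<Sum>a\<in>A. single a (lookup f a))"
    by (rule sum.mono_neutral_left) (use assms in \<open>auto simp: in_keys_iff\<close>)
  also have "\<dots> = (\<Sum>a\<in>A. Const (lookup f a) * mono_of a)"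
    by (simp add: mono_of_def Const_mult_single)
  finally have "L f = L (\<Sum>a\<in>A. Const (lookup f a) * mono_of a)"
    by simp
  also have "\<dots> = (\<Sum>a\<in>A. lookup f a * L (mono_of a))"
    using le by (subst dual_sum[OF assms(1)])
      (auto simp: dual_Const_mult[OF assms(1)] intro: polys_le_Const_mult)
  finally show ?thesis .
qed

lemma dual_has_derivative:
  fixes F :: "real \<Rightarrow> ('m::finite, real) mpoly"
  assumes "L \<in> dual k" "has_coeff_deriv F F' s" "\<And>t. F t \<in> polys_le k" "F' \<in> polys_le k"
  shows "((\<lambda>t. L (F t)) has_real_derivative L F') (at s)"
proof -
  let ?A = "{a :: 'm \<Rightarrow>\<^sub>0 nat. mdeg a \<le> k}"
  have expand: "L f = (\<Sum>a\<in>?A. lookup f a * L (mono_of a))" if "f \<in> polys_le k" for f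
    using that by (intro dual_expand[OF assms(1) finite_mdeg_le]) (auto simp: polys_le_def)
  have "((\<lambda>t. \<Sum>a\<in>?A. lookup (F t) a * L (mono_of a)) has_real_derivative
      (\<Sum>a\<in>?A. lookup F' a * L (mono_of a))) (at s)"
    using assms(2) by (intro DERIV_sum DERIV_cmult_right) (simp add: has_coeff_deriv_def)
  then show ?thesis
    using expand assms(3,4) by simp
qed

lemma has_coeff_deriv_Const_mult: "has_coeff_deriv (\<lambda>t. Const t * f) f s"
  unfolding has_coeff_deriv_def lookup_Const_mult
  by (auto intro!: derivative_eq_intros)

text \<open>
  The function \<open>\<psi> s = L (h (x + s (X - x)))\<close>, with \<open>x = L X\<close>, has \<open>\<psi>' 0 = 0\<close> since
  \<open>L (X - x) = 0\<close>, and \<open>\<psi>'' \<ge> 0\<close> since the factorisation of the Hessian turns \<open>\<psi>''\<close> into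
  \<open>L\<close> of a sum of squares. Hence \<open>\<psi> 0 \<le> \<psi> 1\<close>.
\<close>

lemma jensen_sos_convex:
  fixes h :: "('m::finite, real) mpoly"
  assumes L: "L \<in> dual (2 * r)" "L 1 = 1" "\<And>q. q \<in> polys_le r \<Longrightarrow> L (q\<^sup>2) \<ge> 0"
    and r: "r \<ge> 1" and h: "h \<in> polys_le (2 * r)" "sos_convex h"
  shows "insertion h (\<chi> i. L (Var i)) \<le> L h"
proof -
  obtain k :: nat and H where H: "\<And>i j. pdiff i (pdiff j h) = (\<Sum>l<k. H l i * H l j)"
    using h(2) unfolding sos_convex_def by blast
  define x where "x = (\<chi> i. L (Var i))"
  define w :: "'m \<Rightarrow> ('m, real) mpoly" where "w i = Var i - Const (x $ i)" for i
  define v where "v t i = Const (x $ i) + Const t * w i" for t i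
  define D1 where "D1 s = (\<Sum>j\<in>UNIV. eval_mpoly Const (v s) (pdiff j h) * w j)" for s
  define D2 where "D2 s =
    (\<Sum>j\<in>UNIV. (\<Sum>i\<in>UNIV. eval_mpoly Const (v s) (pdiff i (pdiff j h)) * w i) * w j)" for s
  have w_le: "w i \<in> polys_le 1" for i
    unfolding w_def by (intro polys_le_diff polys_le_Var polys_le_Const order_refl)
  have v_le: "v s i \<in> polys_le 1" for s i
    unfolding v_def by (intro polys_le_add polys_le_Const polys_le_Const_mult w_le)
  have eval_le: "eval_mpoly Const (v s) f \<in> polys_le n" if "f \<in> polys_le n" for s f n
    using polys_le_eval v_le that by blast
  have dd_le: "pdiff i (pdiff j h) \<in> polys_le (2 * (r - 1))" for i j
    using polys_le_pdiff[OF polys_le_pdiff[OF h(1)]] by (simp add: algebra_simps)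
  \<comment> \<open>The diagonal entry \<open>i, i\<close> is the sum of squares of column
    \<open>i\<close> and has degree at most \<open>2 * (r - 1)\<close>.\<close>
  have H_le: "H l i \<in> polys_le (r - 1)" if "l < k" for l i
    by (rule polys_le_of_sum_squares[of "{..<k}" "\<lambda>l. H l i"]) (use that dd_le[of i i] H in auto)
  have v_deriv: "has_coeff_deriv (\<lambda>t. v t i) (w i) s" for i s
    unfolding v_def
    using has_coeff_deriv_add[OF has_coeff_deriv_const has_coeff_deriv_Const_mult] by simp
  have D1_le: "D1 s \<in> polys_le (2 * r)" for s
    unfolding D1_def
  proof (rule polys_le_sum)
    fix j
    have "eval_mpoly Const (v s) (pdiff j h) * w j \<in> polys_le ((2 * r - 1) + 1)"
      by (intro polys_le_mult eval_le polys_le_pdiff h w_le)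
    then show "eval_mpoly Const (v s) (pdiff j h) * w j \<in> polys_le (2 * r)"
      using r by simp
  qed
  define Q where "Q s l = (\<Sum>i\<in>UNIV. eval_mpoly Const (v s) (H l i) * w i)" for s l
  have Q_le: "Q s l \<in> polys_le r" if "l < k" for s l
    unfolding Q_def
  proof (rule polys_le_sum)
    fix i
    have "eval_mpoly Const (v s) (H l i) * w i \<in> polys_le ((r - 1) + 1)"
      by (intro polys_le_mult eval_le H_le that w_le)
    then show "eval_mpoly Const (v s) (H l i) * w i \<in> polys_le r"
      using r by simp
  qed
  \<comment> \<open>With the Hessian equal to \<open>H^T H\<close>, the quadratic form in
    \<open>w\<close> is the squared length of \<open>H w\<close>; its components are the
    \<open>Q s l\<close>, of degree at most \<open>r\<close>.\<close>
  have D2_eq: "D2 s = (\<Sum>l<k. (Q s l)\<^sup>2)" for s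
  proof -
    have "D2 s = (\<Sum>j\<in>UNIV. \<Sum>i\<in>UNIV. \<Sum>l<k.
        (eval_mpoly Const (v s) (H l j) * w j) * (eval_mpoly Const (v s) (H l i) * w i))"
      unfolding D2_def H subst.eval_sum subst.eval_mult sum_distrib_right
      by (simp only: mult_ac)
    also have "\<dots> = (\<Sum>l<k. \<Sum>j\<in>UNIV. \<Sum>i\<in>UNIV.
        (eval_mpoly Const (v s) (H l j) * w j) * (eval_mpoly Const (v s) (H l i) * w i))"
      by (simp only: sum.swap[where A = UNIV and B = "{..<k}"])
    also have "\<dots> = (\<Sum>l<k. (Q s l)\<^sup>2)"
      by (simp add: Q_def power2_eq_square sum_product)
    finally show ?thesis .
  qed
  have D2_le: "D2 s \<in> polys_le (2 * r)" for s
    unfolding D2_eq by (intro polys_le_sum polys_le_square Q_le) simp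
  have psi: "((\<lambda>t. L (eval_mpoly Const (v t) h)) has_real_derivative L (D1 s)) (at s)" for s
    unfolding D1_def
    by (rule dual_has_derivative[OF L(1) has_coeff_deriv_eval[OF v_deriv]])
      (use D1_le eval_le h(1) in \<open>auto simp: D1_def\<close>)
  have "has_coeff_deriv D1 (D2 s) s" for s
    unfolding D1_def[abs_def] D2_def
  proof (rule has_coeff_deriv_sum)
    fix j
    show "has_coeff_deriv (\<lambda>s. eval_mpoly Const (v s) (pdiff j h) * w j)
        ((\<Sum>i\<in>UNIV. eval_mpoly Const (v s) (pdiff i (pdiff j h)) * w i) * w j) s"
      using has_coeff_deriv_mult[OF has_coeff_deriv_eval[OF v_deriv] has_coeff_deriv_const]
      by simp
  qed
  then have psi': "((\<lambda>t. L (D1 t)) has_real_derivative L (D2 s)) (at s)" for s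
    by (rule dual_has_derivative[OF L(1)]) (rule D1_le D2_le)+
  have D2_nonneg: "L (D2 s) \<ge> 0" for s
    unfolding D2_eq
    by (subst dual_sum[OF L(1)]) (auto intro!: polys_le_square Q_le L(3) sum_nonneg)
  have v0: "v 0 = (\<lambda>i. Const (x $ i))"
    by (simp add: v_def Const_zero fun_eq_iff)
  have v1: "v 1 = Var"
    by (simp add: v_def w_def Const_one fun_eq_iff)
  have Lw: "L (w i) = 0" for i
  proof -
    have "w i = Var i + Const (- 1) * Const (x $ i)"
      by (simp add: w_def Const_def mult_single single_uminus)
    then have "L (w i) = L (Var i) + (- 1) * L (Const (x $ i))"
      using r by (simp only: dual_add[OF L(1)] dual_Const_mult[OF L(1)] polys_le_Var
          polys_le_Const polys_le_Const_mult)
    then show ?thesis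
      by (simp add: dual_Const[OF L(1)] L(2) x_def)
  qed
  \<comment> \<open>At \<open>s = 0\<close> the gradient is evaluated at the point \<open>x\<close>,
    so its entries are constants and leave \<open>L\<close>.\<close>
  have "L (D1 0) = (\<Sum>j\<in>UNIV. insertion (pdiff j h) x * L (w j))"
  proof -
    have w_le': "w j \<in> polys_le (2 * r)" for j
      using w_le polys_le_mono r by (metis One_nat_def mult_2 trans_le_add1)
    show ?thesis
      unfolding D1_def v0 eval_at_Const
      by (subst dual_sum[OF L(1)])
        (auto simp: dual_Const_mult[OF L(1) w_le'] intro: polys_le_Const_mult w_le')
  qed
  then have "L (D1 0) = 0"
    by (simp add: Lw)
  then have psi'_nonneg: "L (D1 s) \<ge> 0" if "s \<ge> 0" for s
    using DERIV_nonneg_imp_nondecreasing[OF that, of "\<lambda>t. L (D1 t)"] psi' D2_nonneg by metis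
  have "L (eval_mpoly Const (v 0) h) \<le> L (eval_mpoly Const (v 1) h)"
    by (rule DERIV_nonneg_imp_nondecreasing) (use psi psi'_nonneg in auto)
  then show ?thesis
    unfolding x_def[symmetric]
    by (simp add: v0 v1 eval_at_Const eval_at_Var dual_Const[OF L(1)] L(2))
qed

section \<open>Relating \<open>K\<close> and \<open>\<Lambda>\<close>\<close>

lemma lookup_at_y: "lookup (at_y p y) a = poly (lookup p a) y"
  by (simp add: at_y_def Poly_Mapping.map.rep_eq when_def)

lemma keys_at_y: "keys (at_y p y) \<subseteq> keys p"
  by (auto simp: in_keys_iff lookup_at_y)

lemma mdeg_le_deg_x: "a \<in> keys p \<Longrightarrow> mdeg a \<le> deg_x p"
  unfolding deg_x_def by (rule Max_ge) auto

lemma degree_le_deg_y: "degree (lookup p a) \<le> deg_y p"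
proof (cases "a \<in> keys p")
  case True
  then show ?thesis
    unfolding deg_y_def by (intro Max_ge) auto
qed (simp add: in_keys_iff)

lemma at_y_polys_le: "deg_x p \<le> k \<Longrightarrow> at_y p y \<in> polys_le k"
  using keys_at_y[of p y] mdeg_le_deg_x[of _ p] by (fastforce simp: polys_le_def)

lemma poly_apply_x:
  assumes "L \<in> dual k" "deg_x p \<le> k"
  shows "poly (apply_x L p) y = L (at_y p y)"
proof -
  \<comment> \<open>The sum runs over \<open>keys p\<close>, since coefficients may vanish at the
    particular \<open>y\<close>.\<close>
  have "L (at_y p y) = (\<Sum>a\<in>keys p. lookup (at_y p y) a * L (mono_of a))"
    using mdeg_le_deg_x[of _ p] assms(2)
    by (intro dual_expand[OF assms(1) finite_keys keys_at_y]) (meson order_trans)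
  then show ?thesis
    by (simp add: apply_x_def poly_sum lookup_at_y mult.commute)
qed

lemma degree_apply_x: "degree (apply_x L p) \<le> deg_y p"
  unfolding apply_x_def
  by (intro degree_sum_le finite_keys order_trans[OF degree_smult_le degree_le_deg_y])

lemma insertion_dual:
  "restrict (\<lambda>f. insertion f x) (polys_le k) \<in> dual k"
  by (auto simp: dual_def polys_le_add polys_le_Const_mult insertion_eq_eval
      point.eval_add point.eval_mult point.eval_Const)

lemma Theta_polys_le:
  assumes "k \<le> r"
  shows "(Theta \<tau> k :: ('m::finite, real) mpoly) \<in> polys_le (2 * r)"
proof -
  have "(Const (1 / \<tau>) * Var i) ^ (2 * k) \<in> polys_le (2 * k * 1)" for i :: 'm
    by (intro polys_le_power polys_le_Const_mult polys_le_Var) simp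
  then have "(Theta \<tau> k :: ('m, real) mpoly) \<in> polys_le (2 * k)"
    unfolding Theta_def by (intro polys_le_sum) simp
  then show ?thesis
    by (rule polys_le_mono[rotated]) (use assms in simp)
qed

text \<open>The numbers \<open>(x_i / \<tau>)^2\<close> are nonnegative with sum at most 1, so each
  lies in the unit interval and a power with exponent at least 1 can only shrink it.\<close>

lemma insertion_Theta_le_1:
  assumes "\<tau> > 0" "norm x \<le> \<tau>" "k \<ge> 1"
  shows "insertion (Theta \<tau> k) x \<le> 1"
proof -
  define z where "z i = (x $ i / \<tau>)\<^sup>2" for i
  have "insertion (Theta \<tau> k) x = (\<Sum>i\<in>UNIV. z i ^ k)"
    by (simp add: Theta_def insertion_eq_eval point.eval_sum point.eval_power point.eval_mult
        point.eval_Const point.eval_Var z_def flip: power_mult)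
  moreover have sum: "(\<Sum>i\<in>UNIV. z i) \<le> 1"
  proof -
    have "(\<Sum>i\<in>UNIV. z i) = (norm x)\<^sup>2 / \<tau>\<^sup>2"
      by (simp add: z_def norm_vec_def L2_set_def power_divide sum_nonneg flip: sum_divide_distrib)
    also have "\<dots> \<le> 1"
      using assms by (simp add: power_mono)
    finally show ?thesis .
  qed
  moreover have "z i ^ k \<le> z i" for i
  proof -
    have "z i \<le> (\<Sum>i\<in>UNIV. z i)"
      by (rule member_le_sum) (auto simp: z_def)
    then have "0 \<le> z i" "z i \<le> 1"
      using sum by (auto simp: z_def)
    then show ?thesis
      using power_decreasing[of 1 k "z i"] assms(3) by simp
  qed
  ultimately show ?thesis
    using sum_mono[of UNIV "\<lambda>i. z i ^ k" z] by simp
qed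

lemma insertion_polys_le_0:
  assumes "f \<in> polys_le 0"
  shows "insertion f x = insertion f u"
proof -
  have "keys f \<subseteq> {0}"
    using assms by (auto simp: polys_le_def mdeg_eq_0_iff)
  then show ?thesis
    unfolding insertion_eq_eval by (simp add: point.eval_superset[of "{0}"])
qed

text \<open>If \<open>p\<close> is constant in \<open>x\<close>, then \<open>K p\<close> is empty or
  the whole space. A Slater point excludes the former, boundedness the latter.\<close>

lemma deg_x_pos:
  fixes p :: "('m::finite, real poly) mpoly"
  assumes "compact (K p)" "slater p"
  shows "deg_x p \<ge> 1"
proof (rule ccontr)
  assume "\<not> deg_x p \<ge> 1"
  then have eq: "insertion (at_y p y) x = insertion (at_y p y) u" for x u y
    by (intro insertion_polys_le_0 at_y_polys_le) simp
  obtain u where "u \<in> K p"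
    using assms(2) by (auto simp: slater_def)
  then have "x \<in> K p" for x
    unfolding K_def using eq[of _ x u] by (simp add: K_def)
  then have "K p = UNIV"
    by blast
  then show False
    using assms(1) compact_imp_bounded not_bounded_UNIV by metis
qed

theorem mainTheorem2:
  fixes p :: "('m::finite, real poly) mpoly" and \<tau> :: real and r t :: nat
  assumes "compact (K p)"
    and "\<tau> > 0"
    and "\<And>x. x \<in> K p \<Longrightarrow> norm x \<le> \<tau>"
    and "slater p"
    and "\<And>y. y \<in> S \<Longrightarrow> sos_convex (- at_y p y)"
    and "r \<ge> nat \<lceil>real (deg_x p) / 2\<rceil>"
    and "t \<ge> d_K p"
  shows "K p = Lambda p \<tau> r t"
proof
  have "deg_x p \<ge> 1"
    using assms deg_x_pos by blast
  then have half: "nat \<lceil>real (deg_x p) / 2\<rceil> \<ge> 1"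
    by linarith
  then have r: "r \<ge> 1" "deg_x p \<le> 2 * r"
    using assms(6) by linarith+
  have t: "deg_y p \<le> 2 * t"
    using assms(7) unfolding d_K_def by linarith
  show "K p \<subseteq> Lambda p \<tau> r t"
  proof
    fix x assume x: "x \<in> K p"
    define L where "L = restrict (\<lambda>f. insertion f x) (polys_le (2 * r))"
    have L: "L \<in> dual (2 * r)"
      unfolding L_def by (rule insertion_dual)
    have L_eq: "L f = insertion f x" if "f \<in> polys_le (2 * r)" for f
      using that by (simp add: L_def)
    have "L (Var i) = x $ i" for i
      using r by (subst L_eq) (simp_all add: polys_le_Var insertion_eq_eval point.eval_Var)
    then have "x = (\<chi> i. L (Var i))"
      by (simp add: vec_eq_iff)
    moreover have "L 1 = 1"
      by (simp add: L_eq insertion_eq_eval point.eval_one)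
    moreover have "L (q\<^sup>2) \<ge> 0" if "q \<in> polys_le r" for q
      by (subst L_eq[OF polys_le_square[OF that]]) (simp add: insertion_eq_eval point.eval_power)
    moreover have "L (Theta \<tau> k) \<le> 1" if "k \<in> {nat \<lceil>real (deg_x p) / 2\<rceil>..r}" for k
    proof -
      have "k \<ge> 1"
        using that half by (meson atLeastAtMost_iff order_trans)
      then have "insertion (Theta \<tau> k) x \<le> 1"
        by (rule insertion_Theta_le_1[OF assms(2) assms(3)[OF x]])
      then show ?thesis
        using that by (simp add: L_eq Theta_polys_le)
    qed
    moreover have "apply_x L p \<in> qmodule t g1"
    proof (rule qmodule_of_nonneg)
      show "degree (apply_x L p) \<le> 2 * t"
        using degree_apply_x t by (rule order_trans)
      show "poly (apply_x L p) y \<ge> 0" if "y \<in> S" for y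
        using x that r by (simp add: poly_apply_x[OF L] L_eq at_y_polys_le K_def)
    qed
    ultimately show "x \<in> Lambda p \<tau> r t"
      unfolding Lambda_def using L by blast
  qed
  show "Lambda p \<tau> r t \<subseteq> K p"
  proof
    fix x assume "x \<in> Lambda p \<tau> r t"
    then obtain L where x: "x = (\<chi> i. L (Var i))" and L: "L \<in> dual (2 * r)" "L 1 = 1"
        "\<And>q. q \<in> polys_le r \<Longrightarrow> L (q\<^sup>2) \<ge> 0" "apply_x L p \<in> qmodule t g1"
      unfolding Lambda_def by blast
    have "insertion (at_y p y) x \<ge> 0" if y: "y \<in> S" for y
    proof -
      have le: "at_y p y \<in> polys_le (2 * r)"
        using r by (intro at_y_polys_le)
      have neg: "- f = Const (- 1) * f" for f :: "('m, real) mpoly"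
        by (simp add: Const_def single_uminus)
      \<comment> \<open>Convexity belongs to \<open>-p\<close>, so Jensen's inequality for
        \<open>-p\<close> bounds \<open>p\<close> at \<open>x\<close> from below by \<open>L\<close>
        of \<open>p\<close>.\<close>
      have "insertion (- at_y p y) x \<le> L (- at_y p y)"
        unfolding x by (rule jensen_sos_convex[OF L(1-3) r(1) polys_le_uminus[OF le] assms(5)[OF y]])
      then have "L (at_y p y) \<le> insertion (at_y p y) x"
        by (simp add: neg dual_Const_mult[OF L(1) le] insertion_eq_eval point.eval_mult
            point.eval_Const)
      moreover have "L (at_y p y) \<ge> 0"
        using qmodule_nonneg[OF L(4) y] by (simp add: poly_apply_x[OF L(1) r(2)])
      ultimately show ?thesis
        by simp
    qed
    then show "x \<in> K p"
      by (simp add: K_def)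
  qed
qed

end
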